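(* (High-temperature expansion on a surface with boundary.) For every relative homology class $\epsilon\in H_1(\Sigma,\partial\Sigma;\mathbb Z/2\mathbb Z)$, $$Z^\epsilon_{\mathrm{Ising}}(G^*_\Sigma,J)=2^{|V_\Sigma^*|}\Bigl(\prod_{e\in E_\Sigma}\cosh(J_{e^*})\Bigr)\sum_{\tau\in H_1(\Sigma;\mathbb Z/2\mathbb Z)}\Bigl[(-1)^{(\tau|\epsilon)}\sum_{P^*\in\mathcal P^\tau(G_\Sigma^* )}\Bigl(\prod_{e^*\in P^*}\tanh(J_{e^*})\Bigr)\Bigr],$$ where $(\tau|\epsilon)$ is the intersection form evaluated at $\tau$ and $\epsilon$, i.e. the parity of the number of intersections of any representative of $\tau$ and any representative of $\epsilon$.
   Context: Let $G=(V,E)$ be a finite graph cellularly embedded in a compact, connected, orientable, boundaryless surface of genus $g\ge0$, with dual graph $G^*=(V^*,E^* )$ (dual vertices in the interior of faces). Let $p\ge0$ and let $B_0,\dots,B_{p-1}$ be pairwise disjoint unions of closed faces of $G$, each homeomorphic to a disc. $\Sigma$ is the surface with the interiors of the $B_i$ removed: a compact orientable surface of genus $g$ with boundary $\partial\Sigma=\partial B_0\cup\dots\cup\partial B_{p-1}$ (empty if $p=0$). $G_\Sigma=(V_\Sigma,E_\Sigma)$: $V_\Sigma=V\cap\Sigma$, and $E_\Sigma$ is the set of edges of $G$ contained in $\Sigma$ and not on $\partial\Sigma$. $G_\Sigma^*=(V_\Sigma^*,E_\Sigma^* )$: $V_\Sigma^*=V^*\cap\Sigma$, and $E_\Sigma^*$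 is the set of dual edges $e^*$ of edges $e\in E_\Sigma$ (they join vertices of $V^*_\Sigma$). Positive coupling constants $(J_{e^*})_{e^*\in E^*}$ are given. Ising model with defect: let $\underline\epsilon\subset E_\Sigma$ be a fixed representative of $\epsilon$, namely the mod 2 union of some of fixed paths $\underline\gamma_1,\dots,\underline\gamma_N$ of $G_\Sigma$ whose classes form a basis of $H_1(\Sigma,\partial\Sigma;\mathbb Z/2\mathbb Z)$ (for each handle two transverse cycles around it, and for $1\le i\le p-1$ a path joining $\partial B_0$ to $\partial B_i$). Then $$Z^\epsilon_{\mathrm{Ising}}(G_\Sigma^*,J)=\sum_{\sigma\in\{-1,1\}^{V_\Sigma^*}}\exp\Bigl(\sum_{e^*=u^*v^*\in E_\Sigma^*}s_\epsilon(e)J_{e^*}\sigma_{u^*}\sigma_{v^*}\Bigr),$$ with $s_\epsilon(e)=-1$ if $e\in\underline\epsilon$ and $1$ otherwise. A polygon configuration of $G_\Sigma^*$ is a subset of $E_\Sigma^*$ such that each vertex of $G_\Sigma^*$ is incident to an even number of its edges. $\mathcal P^\tau(G_\Sigma^* )$ is the set of those with class $\tau\in H_1(\Sigma;\mathbb Z/2\mathbb Z)$. *)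

theory Defs
  imports
    Complex_Main
    "Graph_Theory.Graph_Theory"
    "HOL-Combinatorics.Orbits"
    "HOL-Algebra.Coset"
    "HOL-Algebra.FiniteProduct"
begin

section \<open>Graphs cellularly embedded in closed oriented surfaces\<close>

text \<open>
  A cellular embedding is given by its combinatorial map. Every undirected edge (loops and
  parallel edges allowed) is a pair of opposite arcs, \<open>opp\<close> exchanges the two, and \<open>rot\<close> sends
  an arc to the next arc out of the same vertex, clockwise in the surface.
\<close>

record ('v, 'a) cmap =
  skel :: "('v, 'a) pre_digraph"
  opp :: "'a \<Rightarrow> 'a"
  rot :: "'a \<Rightarrow> 'a"

definition edge_of :: "('v, 'a) cmap \<Rightarrow> 'a \<Rightarrow> 'a set" where
  "edge_of M a = {a, opp M a}"

definition edges :: "('v, 'a) cmap \<Rightarrow> 'a set set" where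
  "edges M = edge_of M ` arcs (skel M)"

text \<open>
  A face is represented by the set of all arcs that have it on their left, and \<open>face_of M a\<close> is the
  face to the left of \<open>a\<close>: having traversed \<open>a\<close>, one continues along that face with the arc following
  \<open>opp a\<close> clockwise. A connected graph without edges is a single vertex on the sphere; its only face
  is bordered by no arc and hence represented by the empty set.
\<close>

definition face_of :: "('v, 'a) cmap \<Rightarrow> 'a \<Rightarrow> 'a set" where
  "face_of M a = orbit (rot M \<circ> opp M) a"

definition faces :: "('v, 'a) cmap \<Rightarrow> 'a set set" where
  "faces M = (if arcs (skel M) = {} then {{}} else face_of M ` arcs (skel M))"

definition embedded_graph :: "('v, 'a) cmap \<Rightarrow> nat \<Rightarrow> bool" where
  "embedded_graph M g \<longleftrightarrow>
     fin_digraph (skel M) \<and>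
     bidirected_digraph (skel M) (opp M) \<and>
     Digraph_Component.connected (skel M) \<and>
     rot M permutes arcs (skel M) \<and>
     (\<forall>v \<in> verts (skel M). out_arcs (skel M) v \<noteq> {} \<longrightarrow> cyclic_on (rot M) (out_arcs (skel M) v)) \<and>
     int (card (verts (skel M))) - int (card (edges M)) + int (card (faces M)) = 2 - 2 * int g"

section \<open>Discs and the surface with boundary\<close>

text \<open>The vertices and edges lying on the union of the closed faces in \<open>X\<close>.\<close>

definition region_verts :: "('v, 'a) cmap \<Rightarrow> 'a set set \<Rightarrow> 'v set" where
  "region_verts M X = tail (skel M) ` \<Union>X"

definition region_edges :: "('v, 'a) cmap \<Rightarrow> 'a set set \<Rightarrow> 'a set set" where
  "region_edges M X = edge_of M ` \<Union>X"

text \<open>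
  The union of the closed faces in \<open>X\<close> is a disc iff it is a connected surface with boundary
  of Euler characteristic 1. The corner to the left of an arc \<open>a\<close>, at its tail, belongs to
  \<open>face_of M a\<close>; the region is a surface at \<open>v\<close> iff its corners at \<open>v\<close> are all the corners or
  consecutive ones, i.e. iff going around \<open>v\<close> one leaves the region at most once. Properness
  matters only for the graph without edges, whose closed face is a sphere.
\<close>

definition disc :: "('v, 'a) cmap \<Rightarrow> 'a set set \<Rightarrow> bool" where
  "disc M X \<longleftrightarrow>
     X \<noteq> {} \<and> X \<subset> faces M \<and>
     (\<forall>Y \<subseteq> X. Y \<noteq> {} \<and> Y \<noteq> X \<longrightarrow> region_verts M Y \<inter> region_verts M (X - Y) \<noteq> {}) \<and>
     (\<forall>v \<in> verts (skel M).
        card {a \<in> out_arcs (skel M) v. face_of M a \<in> X \<and> face_of M (rot M a) \<notin> X} \<le> 1) \<and>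
     int (card (region_verts M X)) - int (card (region_edges M X)) + int (card X) = 1"

text \<open>
  Below, \<open>H\<close> is the set of all faces contained in one of the removed discs. As these are disjoint
  closed discs, a vertex or an edge lies in the interior of one of them iff all faces around it
  are in \<open>H\<close>, and on the boundary \<open>\<partial>\<Sigma>\<close> iff some but not all of them are.
\<close>

definition inner_verts :: "('v, 'a) cmap \<Rightarrow> 'a set set \<Rightarrow> 'v set" where
  "inner_verts M H = {v \<in> verts (skel M).
     \<not> (out_arcs (skel M) v \<noteq> {} \<and> (\<forall>a \<in> out_arcs (skel M) v. face_of M a \<in> H))}"

definition inner_arcs :: "('v, 'a) cmap \<Rightarrow> 'a set set \<Rightarrow> 'a set" where
  "inner_arcs M H = {a \<in> arcs (skel M). face_of M a \<notin> H \<and> face_of M (opp M a) \<notin> H}"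

definition inner_graph :: "('v, 'a) cmap \<Rightarrow> 'a set set \<Rightarrow> ('v, 'a) pre_digraph" where
  "inner_graph M H = \<lparr>verts = inner_verts M H, arcs = inner_arcs M H,
                      tail = tail (skel M), head = head (skel M)\<rparr>"

text \<open>
  \<open>inner_edges\<close> is \<open>E\<^sub>\<Sigma>\<close> and \<open>inner_faces\<close> is \<open>V\<^sub>\<Sigma>\<^sup>*\<close>. A dual vertex is identified with the face that
  contains it and a dual edge \<open>e\<^sup>*\<close> with \<open>e\<close>, so that \<open>inner_edges\<close> is \<open>E\<^sub>\<Sigma>\<^sup>*\<close> too. The
  end points of the dual edge of \<open>edge_of M a\<close> are \<open>face_of M a\<close> and \<open>face_of M (opp M a)\<close>.
\<close>

definition inner_edges :: "('v, 'a) cmap \<Rightarrow> 'a set set \<Rightarrow> 'a set set" where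
  "inner_edges M H = edge_of M ` inner_arcs M H"

definition inner_faces :: "('v, 'a) cmap \<Rightarrow> 'a set set \<Rightarrow> 'a set set" where
  "inner_faces M H = faces M - H"

definition bdry_verts :: "('v, 'a) cmap \<Rightarrow> 'a set set \<Rightarrow> 'v set" where
  "bdry_verts M H = {v \<in> verts (skel M).
     (\<exists>a \<in> out_arcs (skel M) v. face_of M a \<in> H) \<and> (\<exists>a \<in> out_arcs (skel M) v. face_of M a \<notin> H)}"

definition bdry_arcs :: "('v, 'a) cmap \<Rightarrow> 'a set set \<Rightarrow> 'a set" where
  "bdry_arcs M H = {a \<in> arcs (skel M). (face_of M a \<in> H) \<noteq> (face_of M (opp M a) \<in> H)}"

section \<open>Cellular homology with coefficients in \<open>\<int>/2\<int>\<close>\<close>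

text \<open>
  A chain with coefficients in \<open>\<int>/2\<int>\<close> is the set of cells with coefficient 1; addition is the
  symmetric difference.
\<close>

definition chain_group :: "'c set set \<Rightarrow> 'c set monoid" where
  "chain_group Z = \<lparr>carrier = Z, mult = sym_diff, one = {}\<rparr>"

definition mod2_sum :: "'i set \<Rightarrow> ('i \<Rightarrow> 'c set) \<Rightarrow> 'c set" where
  "mod2_sum I f = {x. odd (card {i \<in> I. x \<in> f i})}"

text \<open>
  First homology of a complex relative to a subcomplex: \<open>C2\<close> and \<open>C1\<close> are the cells of the
  complex, \<open>A1\<close> and \<open>A0\<close> those of the subcomplex, and \<open>d2\<close>, \<open>d1\<close> the boundaries of single cells.
\<close>

definition cycles1 :: "('c1 \<Rightarrow> 'c0 set) \<Rightarrow> 'c1 set \<Rightarrow> 'c0 set \<Rightarrow> 'c1 set set" where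
  "cycles1 d1 C1 A0 = {c. c \<subseteq> C1 \<and> mod2_sum c d1 \<subseteq> A0}"

definition boundaries1 :: "('c2 \<Rightarrow> 'c1 set) \<Rightarrow> 'c2 set \<Rightarrow> 'c1 set \<Rightarrow> 'c1 set set" where
  "boundaries1 d2 C2 A1 = {sym_diff (mod2_sum q d2) b | q b. q \<subseteq> C2 \<and> b \<subseteq> A1}"

definition homology1 ::
  "('c2 \<Rightarrow> 'c1 set) \<Rightarrow> ('c1 \<Rightarrow> 'c0 set) \<Rightarrow> 'c2 set \<Rightarrow> 'c1 set \<Rightarrow> 'c1 set \<Rightarrow> 'c0 set \<Rightarrow> 'c1 set set monoid"
where
  "homology1 d2 d1 C2 C1 A1 A0 = chain_group (cycles1 d1 C1 A0) Mod boundaries1 d2 C2 A1"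

definition hclass :: "('c2 \<Rightarrow> 'c1 set) \<Rightarrow> 'c2 set \<Rightarrow> 'c1 set \<Rightarrow> 'c1 set \<Rightarrow> 'c1 set set" where
  "hclass d2 C2 A1 c = boundaries1 d2 C2 A1 #>\<^bsub>chain_group UNIV\<^esub> c"

text \<open>
  The cell complex used is the overlay of the graph and its dual, which contains both as subcomplexes
  of its 1-skeleton. Its 0-cells are the vertices, the dual vertices and the crossing points
  of edges with their dual edges. \<open>Half a\<close> is the first half of the arc \<open>a\<close>, and \<open>Dual_Half a\<close> is
  the half of the dual edge that joins the crossing point of \<open>a\<close> to the dual vertex on the left of \<open>a\<close>.
  There is one quadrangular 2-cell per corner; the one named \<open>a\<close> is the corner between \<open>a\<close> and
  \<open>rot a\<close>, which lies to the right of \<open>a\<close> and to the left of \<open>rot a\<close>.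
  If two sides of a quadrangle coincide, their coefficients cancel.
\<close>

datatype ('v, 'a) point = Vertex 'v | Dual_Vertex "'a set" | Crossing "'a set"

datatype 'a segment = Half 'a | Dual_Half 'a

fun segment_bd :: "('v, 'a) cmap \<Rightarrow> 'a segment \<Rightarrow> ('v, 'a) point set" where
  "segment_bd M (Half a) = {Vertex (tail (skel M) a), Crossing (edge_of M a)}"
| "segment_bd M (Dual_Half a) = {Dual_Vertex (face_of M a), Crossing (edge_of M a)}"

definition quad_bd :: "('v, 'a) cmap \<Rightarrow> 'a \<Rightarrow> 'a segment set" where
  "quad_bd M a = sym_diff (sym_diff {Half a} {Half (rot M a)})
                          (sym_diff {Dual_Half (opp M a)} {Dual_Half (rot M a)})"

text \<open>The cells of the surface \<open>\<Sigma>\<close> and of its boundary.\<close>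

definition surface_quads :: "('v, 'a) cmap \<Rightarrow> 'a set set \<Rightarrow> 'a set" where
  "surface_quads M H = {a \<in> arcs (skel M). face_of M (opp M a) \<notin> H}"

definition surface_segments :: "('v, 'a) cmap \<Rightarrow> 'a set set \<Rightarrow> 'a segment set" where
  "surface_segments M H =
     Half ` (inner_arcs M H \<union> bdry_arcs M H) \<union> Dual_Half ` {a \<in> arcs (skel M). face_of M a \<notin> H}"

definition bdry_segments :: "('v, 'a) cmap \<Rightarrow> 'a set set \<Rightarrow> 'a segment set" where
  "bdry_segments M H = Half ` bdry_arcs M H"

definition bdry_points :: "('v, 'a) cmap \<Rightarrow> 'a set set \<Rightarrow> ('v, 'a) point set" where
  "bdry_points M H = Vertex ` bdry_verts M H \<union> Crossing ` edge_of M ` bdry_arcs M H"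

definition H1 :: "('v, 'a) cmap \<Rightarrow> 'a set set \<Rightarrow> 'a segment set set monoid" where
  "H1 M H = homology1 (quad_bd M) (segment_bd M) (surface_quads M H) (surface_segments M H) {} {}"

definition H1_rel :: "('v, 'a) cmap \<Rightarrow> 'a set set \<Rightarrow> 'a segment set set monoid" where
  "H1_rel M H = homology1 (quad_bd M) (segment_bd M) (surface_quads M H) (surface_segments M H)
                          (bdry_segments M H) (bdry_points M H)"

text \<open>The class in \<open>H1\<close> of a set of dual edges, and the class in \<open>H1_rel\<close> of a set of edges.\<close>

definition dual_class :: "('v, 'a) cmap \<Rightarrow> 'a set set \<Rightarrow> 'a set set \<Rightarrow> 'a segment set set" where
  "dual_class M H P = hclass (quad_bd M) (surface_quads M H) {} (Dual_Half ` \<Union>P)"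

definition rel_class :: "('v, 'a) cmap \<Rightarrow> 'a set set \<Rightarrow> 'a set set \<Rightarrow> 'a segment set set" where
  "rel_class M H A = hclass (quad_bd M) (surface_quads M H) (bdry_segments M H) (Half ` \<Union>A)"

section \<open>Polygon configurations and the intersection form\<close>

text \<open>A dual loop at \<open>f\<close> has \<open>f\<close> on both sides and contributes 2 to the degree of \<open>f\<close>.\<close>

definition polygon :: "('v, 'a) cmap \<Rightarrow> 'a set set \<Rightarrow> 'a set set \<Rightarrow> bool" where
  "polygon M H P \<longleftrightarrow> P \<subseteq> inner_edges M H \<and>
     (\<forall>f \<in> inner_faces M H. even (card {a \<in> \<Union>P. face_of M a = f}))"

definition polygons :: "('v, 'a) cmap \<Rightarrow> 'a set set \<Rightarrow> 'a segment set set \<Rightarrow> 'a set set set" where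
  "polygons M H \<tau> = {P. polygon M H P \<and> dual_class M H P = \<tau>}"

definition rel_cycle :: "('v, 'a) cmap \<Rightarrow> 'a set set \<Rightarrow> 'a set set \<Rightarrow> bool" where
  "rel_cycle M H A \<longleftrightarrow> A \<subseteq> inner_edges M H \<and>
     (\<forall>v \<in> inner_verts M H - bdry_verts M H. even (card {a \<in> \<Union>A. tail (skel M) a = v}))"

text \<open>
  Representatives are taken in the dual graph and in the graph, respectively: these always meet
  transversally, namely where an edge of one crosses its own dual edge in the other.
\<close>

definition intersection_form ::
  "('v, 'a) cmap \<Rightarrow> 'a set set \<Rightarrow> 'a segment set set \<Rightarrow> 'a segment set set \<Rightarrow> nat" where
  "intersection_form M H \<tau> \<epsilon> =
     (THE n. \<forall>P A. polygon M H P \<and> dual_class M H P = \<tau> \<and> rel_cycle M H A \<and> rel_class M H A = \<epsilon>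
               \<longrightarrow> n = card (P \<inter> A) mod 2)"

section \<open>The Ising model with defect\<close>

definition odd_edges :: "('v, 'a) cmap \<Rightarrow> 'a list \<Rightarrow> 'a set set" where
  "odd_edges M w = {e. odd (length (filter (\<lambda>a. edge_of M a = e) w))}"

text \<open>
  \<open>\<gamma>s\<close> is a family of paths of \<open>G\<^sub>\<Sigma>\<close>, each closed or with both ends on the boundary, whose classes form
  a basis of \<open>H1_rel\<close>. A linear combination over \<open>\<int>/2\<int>\<close> is the sum of a subfamily.
\<close>

definition path_basis :: "('v, 'a) cmap \<Rightarrow> 'a set set \<Rightarrow> 'a list list \<Rightarrow> bool" where
  "path_basis M H \<gamma>s \<longleftrightarrow>
     (\<forall>w \<in> set \<gamma>s. \<exists>u v. pre_digraph.awalk (inner_graph M H) u w v \<and>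
                          (u = v \<or> u \<in> bdry_verts M H \<and> v \<in> bdry_verts M H)) \<and>
     (\<forall>\<epsilon> \<in> carrier (H1_rel M H). \<exists>!I. I \<subseteq> {..<length \<gamma>s} \<and>
        finprod (H1_rel M H) (\<lambda>i. rel_class M H (odd_edges M (\<gamma>s ! i))) I = \<epsilon>)"

text \<open>The representative of \<open>\<epsilon>\<close> that is a mod 2 union of some of the paths.\<close>

definition defect :: "('v, 'a) cmap \<Rightarrow> 'a set set \<Rightarrow> 'a list list \<Rightarrow> 'a segment set set \<Rightarrow> 'a set set" where
  "defect M H \<gamma>s \<epsilon> =
     (let sub = \<lambda>I. mod2_sum I (\<lambda>i. odd_edges M (\<gamma>s ! i))
      in sub (THE I. I \<subseteq> {..<length \<gamma>s} \<and> rel_class M H (sub I) = \<epsilon>))"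

definition spins :: "('v, 'a) cmap \<Rightarrow> 'a set set \<Rightarrow> ('a set \<Rightarrow> real) set" where
  "spins M H = (inner_faces M H \<rightarrow>\<^sub>E {-1, 1})"

text \<open>For \<open>e = {a, opp a}\<close>, the product over \<open>e\<close> is the product of the spins at the two ends of \<open>e\<^sup>*\<close>.\<close>

definition Z_Ising :: "('v, 'a) cmap \<Rightarrow> 'a set set \<Rightarrow> ('a set \<Rightarrow> real) \<Rightarrow> 'a set set \<Rightarrow> real" where
  "Z_Ising M H J D =
     (\<Sum>\<sigma> \<in> spins M H. exp (\<Sum>e \<in> inner_edges M H.
        (if e \<in> D then -1 else 1) * J e * (\<Prod>a \<in> e. \<sigma> (face_of M a))))"

end

theory Submission
  imports Defs
begin

text \<open>
  For \<open>s = \<plusminus>1\<close> one has \<open>exp (J * s) = cosh J * (1 + s * tanh J)\<close>. Multiplying this out over all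
  edges turns the partition function with defect \<open>D\<close> into a sum over sets \<open>P\<close> of dual edges, and
  summing over the spins annihilates every \<open>P\<close> that meets some face an odd number of times. What
  remains is a sum over polygon configurations in which \<open>P\<close> carries the sign \<open>(-1) ^ card (P \<inter> D)\<close>
  (lemma \<open>Z_Ising_polygons\<close>). Sorting the configurations by their homology class gives the formula
  as soon as this sign is known to depend only on the class of \<open>P\<close> and the relative class of \<open>D\<close>.

  This invariance is read off the overlay complex. A sum of quadrangles whose boundary contains no
  half of an edge of the graph contains, with one corner, all corners around the same vertex;
  its boundary is therefore the set of dual edges crossing a cut, the edges between a set \<open>S\<close> of
  vertices and its complement (\<open>dual_boundary_is_cut\<close>). All faces around a vertex of \<open>S\<close> belong to the
  surface with boundary, so \<open>S\<close> lies off the boundary, every vertex of \<open>S\<close> has even degree in a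
  relative cycle, and a relative cycle meets the cut in an even number of edges. Hence homologous
  polygon configurations meet it with the same parity. The dual argument, with faces instead of
  vertices, handles the relative cycle (\<open>rel_boundary_is_cut\<close>); boundary segments make no difference
  there, because edges with a dual edge in the surface are never on the boundary.

  The defect is a relative cycle of class \<open>\<epsilon>\<close> (\<open>defect_represents\<close>): a path has odd degree only at its
  two ends, and only if these differ and hence lie on the boundary; moreover, passing to classes is
  a homomorphism, so that the product of the classes of some basis paths is the class of their
  mod 2 union.
\<close>

section \<open>Parity\<close>

lemma odd_card_sym_diff:
  assumes "finite X" "finite Y"
  shows "odd (card (sym_diff X Y)) \<longleftrightarrow> odd (card X) \<noteq> odd (card Y)"
proof -
  have X: "card X = card (X - Y) + card (X \<inter> Y)" and Y: "card Y = card (Y - X) + card (X \<inter> Y)"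
    using assms by (simp_all add: card_Diff_subset_Int card_mono Int_commute)
  have "card (sym_diff X Y) = card (X - Y) + card (Y - X)"
    using assms by (intro card_Un_disjoint) auto
  with X Y show ?thesis by auto
qed

lemma even_card_fibres:
  assumes "finite X" "\<And>y. y \<in> f ` X \<Longrightarrow> even (card {x \<in> X. f x = y})"
  shows "even (card X)"
proof -
  have "card X = (\<Sum>y\<in>f ` X. card {x \<in> X. f x = y})"
    using sum.image_gen[OF assms(1), of "\<lambda>_. 1::nat" f] by simp
  then show ?thesis using assms(2) by (simp add: dvd_sum)
qed

lemma mem_mod2_sum: "x \<in> mod2_sum I f \<longleftrightarrow> odd (card {i \<in> I. x \<in> f i})"
  by (simp add: mod2_sum_def)

lemma mod2_sum_empty [simp]: "mod2_sum {} f = {}"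
  by (simp add: mod2_sum_def)

lemma mod2_sum_singleton [simp]: "mod2_sum {i} f = f i"
proof -
  have "{j. j = i \<and> x \<in> f j} = (if x \<in> f i then {i} else {})" for x by auto
  then show ?thesis by (auto simp: mod2_sum_def)
qed

lemma mod2_sum_sym_diff:
  assumes "finite I" "finite K"
  shows "mod2_sum (sym_diff I K) f = sym_diff (mod2_sum I f) (mod2_sum K f)"
proof -
  have "{i \<in> sym_diff I K. x \<in> f i} = sym_diff {i \<in> I. x \<in> f i} {i \<in> K. x \<in> f i}" for x
    by auto
  then have "x \<in> mod2_sum (sym_diff I K) f \<longleftrightarrow> x \<in> sym_diff (mod2_sum I f) (mod2_sum K f)" for x
    using odd_card_sym_diff[of "{i \<in> I. x \<in> f i}" "{i \<in> K. x \<in> f i}"] assms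
    by (simp add: mem_mod2_sum) blast
  then show ?thesis by blast
qed

lemma mod2_sum_insert:
  assumes "finite I" "i \<notin> I"
  shows "mod2_sum (insert i I) f = sym_diff (f i) (mod2_sum I f)"
proof -
  have "insert i I = sym_diff {i} I" using assms by auto
  then show ?thesis using mod2_sum_sym_diff[of "{i}" I f] assms by simp
qed

lemma mod2_sum_subset:
  assumes "\<And>i. i \<in> I \<Longrightarrow> f i \<subseteq> S"
  shows "mod2_sum I f \<subseteq> S"
proof
  fix x assume "x \<in> mod2_sum I f"
  then have "{i \<in> I. x \<in> f i} \<noteq> {}" by (metis mem_mod2_sum card.empty even_zero)
  then show "x \<in> S" using assms by blast
qed

lemma mod2_sum_mod2_sum:
  assumes "finite I" "\<And>i. i \<in> I \<Longrightarrow> finite (f i)"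
  shows "mod2_sum (mod2_sum I f) d = mod2_sum I (\<lambda>i. mod2_sum (f i) d)"
  using assms
proof (induction I rule: finite_induct)
  case (insert i I)
  have "finite (mod2_sum I f)"
    using insert.prems insert.hyps by (intro finite_subset[OF mod2_sum_subset[of I f "\<Union>(f ` I)"]]) auto
  then show ?case using insert by (simp add: mod2_sum_insert mod2_sum_sym_diff)
qed simp


section \<open>Homology of a finite complex modulo 2\<close>

lemma hclass_eq: "hclass d2 C2 A1 c = (\<lambda>b. sym_diff b c) ` boundaries1 d2 C2 A1"
  by (simp add: hclass_def r_coset_def chain_group_def UNION_singleton_eq_range)

lemma carrier_homology1:
  "carrier (homology1 d2 d1 C2 C1 A1 A0) = hclass d2 C2 A1 ` cycles1 d1 C1 A0"
  by (simp add: homology1_def carrier_FactGroup hclass_def r_coset_def chain_group_def)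

lemma empty_in_boundaries1: "{} \<in> boundaries1 d2 C2 A1"
  unfolding boundaries1_def by (rule CollectI, intro exI[of _ "{}"]) simp

text \<open>
  The representative \<open>c\<close> itself lies in its class, so that equality of classes can be tested on it.
\<close>

lemma hclass_eqD:
  assumes "hclass d2 C2 A1 c = hclass d2 C2 A1 c'"
  obtains q b where "q \<subseteq> C2" "b \<subseteq> A1" "sym_diff c c' = sym_diff (mod2_sum q d2) b"
proof -
  have "sym_diff {} c \<in> hclass d2 C2 A1 c"
    unfolding hclass_eq using empty_in_boundaries1 by (rule imageI)
  then have "c \<in> hclass d2 C2 A1 c'" using assms by simp
  then obtain h where "h \<in> boundaries1 d2 C2 A1" "c = sym_diff h c'"
    unfolding hclass_eq by blast
  moreover from this have "sym_diff c c' = h" by blast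
  ultimately show thesis using that unfolding boundaries1_def by blast
qed

lemma comm_group_chain_group:
  assumes "{} \<in> Z" "\<And>x y. x \<in> Z \<Longrightarrow> y \<in> Z \<Longrightarrow> sym_diff x y \<in> Z"
  shows "comm_group (chain_group Z)"
proof (rule comm_groupI)
  fix x assume "x \<in> carrier (chain_group Z)"
  then show "\<exists>y\<in>carrier (chain_group Z). y \<otimes>\<^bsub>chain_group Z\<^esub> x = \<one>\<^bsub>chain_group Z\<^esub>"
    by (intro bexI[of _ x]) (auto simp: chain_group_def)
qed (use assms in \<open>auto simp: chain_group_def\<close>)

text \<open>
  Besides finiteness, these are the axioms of a chain complex in degrees 2, 1, 0 and a subcomplex
  of dimension 1; the 0-cells enter only through \<open>d1\<close> and \<open>A0\<close>.
\<close>

locale finite_complex =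
  fixes d2 :: "'c2 \<Rightarrow> 'c1 set" and d1 :: "'c1 \<Rightarrow> 'c0 set"
    and C2 :: "'c2 set" and C1 A1 :: "'c1 set" and A0 :: "'c0 set"
  assumes finite_C2: "finite C2" and finite_C1: "finite C1"
    and d2_C1: "\<And>q. q \<in> C2 \<Longrightarrow> d2 q \<subseteq> C1"
    and d1_d2: "\<And>q. q \<in> C2 \<Longrightarrow> mod2_sum (d2 q) d1 = {}"
    and A1_C1: "A1 \<subseteq> C1"
    and d1_A0: "\<And>b. b \<in> A1 \<Longrightarrow> d1 b \<subseteq> A0"
begin

lemma cycles1_sym_diff:
  assumes "x \<in> cycles1 d1 C1 A0" "y \<in> cycles1 d1 C1 A0"
  shows "sym_diff x y \<in> cycles1 d1 C1 A0"
proof -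
  have "finite x" "finite y"
    using assms finite_C1 by (auto simp: cycles1_def intro: finite_subset)
  then show ?thesis using assms by (auto simp: cycles1_def mod2_sum_sym_diff)
qed

lemma empty_in_cycles1: "{} \<in> cycles1 d1 C1 A0"
  by (simp add: cycles1_def)

sublocale cycles: comm_group "chain_group (cycles1 d1 C1 A0)"
  by (intro comm_group_chain_group empty_in_cycles1 cycles1_sym_diff)

text \<open>
  That boundaries are cycles is what makes the quotient defining the homology a group, and \<open>finprod\<close>
  in it meaningful.
\<close>

lemma boundaries1_subset_cycles1: "boundaries1 d2 C2 A1 \<subseteq> cycles1 d1 C1 A0"
proof
  fix c assume "c \<in> boundaries1 d2 C2 A1"
  then obtain q b where c: "c = sym_diff (mod2_sum q d2) b" and q: "q \<subseteq> C2" and b: "b \<subseteq> A1"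
    by (auto simp: boundaries1_def)
  have fin: "finite q" "\<And>i. i \<in> q \<Longrightarrow> finite (d2 i)"
    using q finite_C2 finite_C1 d2_C1 by (auto intro: finite_subset)
  have "mod2_sum q (\<lambda>i. mod2_sum (d2 i) d1) \<subseteq> {}"
    by (rule mod2_sum_subset) (use q d1_d2 in auto)
  then have "mod2_sum (mod2_sum q d2) d1 = {}" by (simp add: mod2_sum_mod2_sum[OF fin])
  moreover have "mod2_sum q d2 \<subseteq> C1" using q d2_C1 by (intro mod2_sum_subset) auto
  ultimately have "mod2_sum q d2 \<in> cycles1 d1 C1 A0"
    by (simp add: cycles1_def)
  moreover have "mod2_sum b d1 \<subseteq> A0" by (rule mod2_sum_subset) (use b d1_A0 in auto)
  with b A1_C1 have "b \<in> cycles1 d1 C1 A0" by (auto simp: cycles1_def)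
  ultimately show "c \<in> cycles1 d1 C1 A0" unfolding c by (rule cycles1_sym_diff)
qed

lemma boundaries1_sym_diff:
  assumes "x \<in> boundaries1 d2 C2 A1" "y \<in> boundaries1 d2 C2 A1"
  shows "sym_diff x y \<in> boundaries1 d2 C2 A1"
proof -
  obtain q b where x: "x = sym_diff (mod2_sum q d2) b" and q: "q \<subseteq> C2" "b \<subseteq> A1"
    using assms(1) by (auto simp: boundaries1_def)
  obtain q' b' where y: "y = sym_diff (mod2_sum q' d2) b'" and q': "q' \<subseteq> C2" "b' \<subseteq> A1"
    using assms(2) by (auto simp: boundaries1_def)
  have "mod2_sum (sym_diff q q') d2 = sym_diff (mod2_sum q d2) (mod2_sum q' d2)"
    using q q' finite_C2 by (intro mod2_sum_sym_diff) (auto intro: finite_subset)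
  then have "sym_diff x y = sym_diff (mod2_sum (sym_diff q q') d2) (sym_diff b b')"
    unfolding x y by auto
  moreover have "sym_diff q q' \<subseteq> C2" "sym_diff b b' \<subseteq> A1" using q q' by auto
  ultimately show ?thesis unfolding boundaries1_def by blast
qed

lemma boundaries1_subgroup: "subgroup (boundaries1 d2 C2 A1) (chain_group (cycles1 d1 C1 A0))"
proof (rule cycles.subgroupI)
  fix c assume c: "c \<in> boundaries1 d2 C2 A1"
  then have "c \<in> cycles1 d1 C1 A0" using boundaries1_subset_cycles1 by auto
  then have "inv\<^bsub>chain_group (cycles1 d1 C1 A0)\<^esub> c = c"
    by (intro cycles.inv_equality) (auto simp: chain_group_def)
  then show "inv\<^bsub>chain_group (cycles1 d1 C1 A0)\<^esub> c \<in> boundaries1 d2 C2 A1" using c by simp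
next
  show "boundaries1 d2 C2 A1 \<noteq> {}" using empty_in_boundaries1[of d2 C2 A1] by auto
qed (use boundaries1_subset_cycles1 boundaries1_sym_diff in \<open>simp_all add: chain_group_def\<close>)

sublocale homology: comm_group "homology1 d2 d1 C2 C1 A1 A0"
  unfolding homology1_def by (intro cycles.abelian_FactGroup boundaries1_subgroup)

lemma hclass_mult:
  assumes "x \<in> cycles1 d1 C1 A0" "y \<in> cycles1 d1 C1 A0"
  shows "hclass d2 C2 A1 x \<otimes>\<^bsub>homology1 d2 d1 C2 C1 A1 A0\<^esub> hclass d2 C2 A1 y
    = hclass d2 C2 A1 (sym_diff x y)"
proof -
  interpret normal "boundaries1 d2 C2 A1" "chain_group (cycles1 d1 C1 A0)"
    using boundaries1_subgroup by (simp add: cycles.normal_iff_subgroup)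
  have "hclass d2 C2 A1 c = boundaries1 d2 C2 A1 #>\<^bsub>chain_group (cycles1 d1 C1 A0)\<^esub> c" for c
    by (simp add: hclass_def r_coset_def chain_group_def)
  then show ?thesis
    using rcos_sum[of x y] assms by (simp add: homology1_def) (simp add: chain_group_def)
qed

text \<open>
  Every chain is its own inverse, so a product of classes over a family is represented by the
  mod 2 union of the family.
\<close>

lemma finprod_hclass:
  assumes "finite I" "\<And>i. i \<in> I \<Longrightarrow> c i \<in> cycles1 d1 C1 A0"
  shows "mod2_sum I c \<in> cycles1 d1 C1 A0"
    and "finprod (homology1 d2 d1 C2 C1 A1 A0) (\<lambda>i. hclass d2 C2 A1 (c i)) I
      = hclass d2 C2 A1 (mod2_sum I c)"
proof -
  have "mod2_sum I c \<in> cycles1 d1 C1 A0 \<and>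
    finprod (homology1 d2 d1 C2 C1 A1 A0) (\<lambda>i. hclass d2 C2 A1 (c i)) I
      = hclass d2 C2 A1 (mod2_sum I c)"
    using assms
  proof (induction I rule: finite_induct)
    case empty
    show ?case by (simp add: empty_in_cycles1 hclass_eq) (simp add: homology1_def)
  next
    case (insert i I)
    have "(\<lambda>i. hclass d2 C2 A1 (c i)) \<in> I \<rightarrow> carrier (homology1 d2 d1 C2 C1 A1 A0)"
      "hclass d2 C2 A1 (c i) \<in> carrier (homology1 d2 d1 C2 C1 A1 A0)"
      using insert.prems by (auto simp: carrier_homology1)
    then show ?case
      using insert by (simp add: homology.finprod_insert hclass_mult mod2_sum_insert cycles1_sym_diff)
  qed
  then show "mod2_sum I c \<in> cycles1 d1 C1 A0"
    and "finprod (homology1 d2 d1 C2 C1 A1 A0) (\<lambda>i. hclass d2 C2 A1 (c i)) I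
      = hclass d2 C2 A1 (mod2_sum I c)" by simp_all
qed

end


section \<open>The overlay complex of a graph on a surface\<close>

locale rotation_system = bidirected_digraph "skel M" "opp M" for M :: "('v, 'a) cmap" +
  fixes H :: "'a set set"
  assumes finite_arcs: "finite (arcs (skel M))"
    and rot_permutes: "rot M permutes arcs (skel M)"
    and rot_cyclic: "\<And>v. v \<in> verts (skel M) \<Longrightarrow> out_arcs (skel M) v \<noteq> {} \<Longrightarrow>
      cyclic_on (rot M) (out_arcs (skel M) v)"
begin

lemma rot_eq_iff [simp]: "rot M a = rot M b \<longleftrightarrow> a = b"
  using permutes_inj[OF rot_permutes] by (auto dest: injD)

lemma rot_in_arcs [simp]: "rot M a \<in> arcs (skel M) \<longleftrightarrow> a \<in> arcs (skel M)"
  using rot_permutes by (rule permutes_in_image)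

lemma opp_in_arcs [simp]: "opp M a \<in> arcs (skel M) \<longleftrightarrow> a \<in> arcs (skel M)"
  by (metis arev_arev arev_dom)

lemma eq_opp_iff: "b = opp M a \<longleftrightarrow> a = opp M b"
  by auto

lemma edge_of_eq_iff: "edge_of M a = edge_of M b \<longleftrightarrow> a = b \<or> a = opp M b"
  by (auto simp: edge_of_def doubleton_eq_iff)

lemma edge_of_opp [simp]: "edge_of M (opp M a) = edge_of M a"
  by (simp add: edge_of_eq_iff)

text \<open>
  Sets of edges are sets of pairs of opposite arcs. As these pairs are disjoint, a set of edges can
  be exchanged with the set of its arcs, on which degrees and chains are defined.
\<close>

lemma mem_Union_edges:
  assumes "A \<subseteq> edges M"
  shows "a \<in> \<Union>A \<longleftrightarrow> edge_of M a \<in> A"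
proof
  assume "a \<in> \<Union>A"
  then obtain b where "edge_of M b \<in> A" "a \<in> edge_of M b" using assms by (auto simp: edges_def)
  then show "edge_of M a \<in> A" by (auto simp: edge_of_def insert_commute)
qed (auto simp: edge_of_def)

lemma opp_mem_Union_edges:
  assumes "A \<subseteq> edges M"
  shows "opp M a \<in> \<Union>A \<longleftrightarrow> a \<in> \<Union>A"
  unfolding mem_Union_edges[OF assms] by simp

lemma inner_arcs_subset: "inner_arcs M H \<subseteq> arcs (skel M)"
  by (auto simp: inner_arcs_def)

lemma inner_edges_subset: "inner_edges M H \<subseteq> edges M"
  using inner_arcs_subset by (auto simp: inner_edges_def edges_def)

lemma finite_inner_edges: "finite (inner_edges M H)"
  unfolding inner_edges_def using finite_subset[OF inner_arcs_subset finite_arcs] by simp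

lemma opp_inner_arcs [simp]: "opp M a \<in> inner_arcs M H \<longleftrightarrow> a \<in> inner_arcs M H"
  by (auto simp: inner_arcs_def)

lemma Union_inner_edges: "\<Union>(inner_edges M H) = inner_arcs M H"
  by (auto simp: inner_edges_def edge_of_def)

lemma Union_subset_inner_arcs: "A \<subseteq> inner_edges M H \<Longrightarrow> \<Union>A \<subseteq> inner_arcs M H"
  using Union_inner_edges by blast

lemma finite_Union: "A \<subseteq> inner_edges M H \<Longrightarrow> finite (\<Union>A)"
  using Union_subset_inner_arcs inner_arcs_subset finite_arcs by (meson finite_subset)

lemma card_edge_Int:
  assumes "a \<in> arcs (skel M)"
  shows "odd (card (edge_of M a \<inter> q)) \<longleftrightarrow> (a \<in> q) \<noteq> (opp M a \<in> q)"
  using arev_neq[OF assms] by (auto simp: edge_of_def Int_insert_left)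

lemma face_in_inner_faces:
  assumes "a \<in> inner_arcs M H"
  shows "face_of M a \<in> inner_faces M H"
proof -
  have "a \<in> arcs (skel M)" using assms inner_arcs_subset by blast
  then show ?thesis using assms by (auto simp: inner_faces_def faces_def inner_arcs_def)
qed

lemma tail_rot [simp]:
  assumes "a \<in> arcs (skel M)" shows "tail (skel M) (rot M a) = tail (skel M) a"
proof -
  have "a \<in> out_arcs (skel M) (tail (skel M) a)" using assms by simp
  then have "rot M a \<in> out_arcs (skel M) (tail (skel M) a)"
    using assms by (intro cyclic_on_inI[OF rot_cyclic]) auto
  then show ?thesis by simp
qed

lemma face_permutes: "(rot M \<circ> opp M) permutes arcs (skel M)"
  using arev_permutes_arcs rot_permutes by (rule permutes_compose)

lemma self_in_face: "a \<in> face_of M a"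
  unfolding face_of_def
  using face_permutes finite_arcs by (intro permutation_self_in_orbit) (auto simp: permutation_permutes)

lemma face_rot [simp]: "face_of M (rot M a) = face_of M (opp M a)"
proof -
  have "rot M a \<in> face_of M (opp M a)"
    unfolding face_of_def using orbit.base[of "rot M \<circ> opp M" "opp M a"] by simp
  then show ?thesis
    unfolding face_of_def using face_permutes finite_arcs
    by (metis cyclic_on_orbit orbit_cyclic_eq3)
qed

text \<open>
  Since \<open>rot\<close> permutes the arcs out of a vertex cyclically, a set of arcs stable under \<open>rot\<close> is a union
  of complete stars of vertices. The next lemma is the analogue for faces.
\<close>

lemma full_at_vertex:
  assumes "a \<in> arcs (skel M)" "b \<in> arcs (skel M)" "tail (skel M) b = tail (skel M) a"
    and "a \<in> q" "\<And>c. c \<in> q \<Longrightarrow> rot M c \<in> q"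
  shows "b \<in> q"
proof -
  have "cyclic_on (rot M) (out_arcs (skel M) (tail (skel M) a))"
    using assms(1) by (intro rot_cyclic) auto
  then have "orbit (rot M) a = out_arcs (skel M) (tail (skel M) a)"
    by (rule orbit_cyclic_eq3) (use assms in auto)
  then have "b \<in> orbit (rot M) a" using assms by simp
  then show ?thesis by induction (use assms in auto)
qed

lemma full_on_face:
  assumes "face_of M b = face_of M a" "a \<in> q" "\<And>c. c \<in> q \<Longrightarrow> rot M (opp M c) \<in> q"
  shows "b \<in> q"
proof -
  have "b \<in> orbit (rot M \<circ> opp M) a" using self_in_face[of b] assms(1) by (simp add: face_of_def)
  then show ?thesis by induction (use assms in auto)
qed

lemma finite_surface_quads: "finite (surface_quads M H)"
  by (simp add: surface_quads_def finite_arcs)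

lemma finite_surface_segments: "finite (surface_segments M H)"
  by (simp add: surface_segments_def finite_arcs inner_arcs_def bdry_arcs_def)

lemma Half_in_quad_bd: "Half x \<in> quad_bd M a \<longleftrightarrow> (x = a) \<noteq> (x = rot M a)"
  by (auto simp: quad_bd_def)

lemma Dual_Half_in_quad_bd: "Dual_Half x \<in> quad_bd M a \<longleftrightarrow> (x = opp M a) \<noteq> (x = rot M a)"
  by (auto simp: quad_bd_def)

text \<open>
  The half of \<open>rot a\<close> separates the corner between \<open>a\<close> and \<open>rot a\<close> from the next one around the same
  vertex. Similarly, the dual half at \<open>rot a\<close> separates that corner from the next one around the
  same face, named \<open>opp (rot a)\<close>. If the two corners coincide, both sides of the equivalence are false.
\<close>

lemma Half_rot_in_boundary:
  assumes "finite q"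
  shows "Half (rot M a) \<in> mod2_sum q (quad_bd M) \<longleftrightarrow> (a \<in> q) \<noteq> (rot M a \<in> q)"
proof -
  have "{i \<in> q. Half (rot M a) \<in> quad_bd M i} = sym_diff (q \<inter> {rot M a}) (q \<inter> {a})"
    by (auto simp: Half_in_quad_bd)
  then show ?thesis
    using odd_card_sym_diff[of "q \<inter> {rot M a}" "q \<inter> {a}"] assms
    by (simp add: mem_mod2_sum Int_insert_right)
qed

lemma Dual_Half_rot_in_boundary:
  assumes "finite q"
  shows "Dual_Half (rot M a) \<in> mod2_sum q (quad_bd M) \<longleftrightarrow> (a \<in> q) \<noteq> (opp M (rot M a) \<in> q)"
proof -
  have "{i \<in> q. Dual_Half (rot M a) \<in> quad_bd M i} = sym_diff (q \<inter> {opp M (rot M a)}) (q \<inter> {a})"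
    unfolding Dual_Half_in_quad_bd by (auto simp: eq_opp_iff)
  then show ?thesis
    using odd_card_sym_diff[of "q \<inter> {opp M (rot M a)}" "q \<inter> {a}"] assms
    by (simp add: mem_mod2_sum Int_insert_right)
qed

text \<open>
  The four sides of a quadrangle join up at the vertex, at the dual vertex and at the two crossing points.
\<close>

lemma boundary_quad_bd:
  assumes "a \<in> arcs (skel M)"
  shows "mod2_sum (quad_bd M a) (segment_bd M) = {}"
proof -
  have "mod2_sum (quad_bd M a) (segment_bd M) =
      sym_diff (sym_diff (segment_bd M (Half a)) (segment_bd M (Half (rot M a))))
        (sym_diff (segment_bd M (Dual_Half (opp M a))) (segment_bd M (Dual_Half (rot M a))))"
    unfolding quad_bd_def by (simp add: mod2_sum_sym_diff)
  also have "\<dots> = {}" using assms by auto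
  finally show ?thesis .
qed

sublocale relative: finite_complex "quad_bd M" "segment_bd M" "surface_quads M H"
  "surface_segments M H" "bdry_segments M H" "bdry_points M H"
proof
  show "bdry_segments M H \<subseteq> surface_segments M H"
    by (auto simp: bdry_segments_def surface_segments_def)
next
  fix s assume "s \<in> bdry_segments M H"
  then obtain a where s: "s = Half a" and a: "a \<in> bdry_arcs M H" by (auto simp: bdry_segments_def)
  then have "a \<in> arcs (skel M)" by (simp add: bdry_arcs_def)
  moreover from this have "a \<in> out_arcs (skel M) (tail (skel M) a)"
    and "rot M a \<in> out_arcs (skel M) (tail (skel M) a)" by simp_all
  moreover have "(face_of M a \<in> H) \<noteq> (face_of M (rot M a) \<in> H)" using a by (simp add: bdry_arcs_def)
  ultimately have "tail (skel M) a \<in> bdry_verts M H"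
    unfolding bdry_verts_def by (metis (mono_tags, lifting) mem_Collect_eq tail_in_verts)
  then show "segment_bd M s \<subseteq> bdry_points M H" using a s by (auto simp: bdry_points_def)
next
  fix a assume "a \<in> surface_quads M H"
  then show "quad_bd M a \<subseteq> surface_segments M H"
    by (auto simp: quad_bd_def surface_quads_def surface_segments_def inner_arcs_def bdry_arcs_def)
next
  fix a assume "a \<in> surface_quads M H"
  then show "mod2_sum (quad_bd M a) (segment_bd M) = {}"
    by (intro boundary_quad_bd) (simp add: surface_quads_def)
qed (rule finite_surface_quads finite_surface_segments)+


section \<open>Cycles of edges and of dual edges\<close>

lemma mem_boundary_Half:
  "x \<in> mod2_sum (Half ` X) (segment_bd M) \<longleftrightarrow> odd (card {a \<in> X. x \<in> segment_bd M (Half a)})"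
proof -
  have "{s \<in> Half ` X. x \<in> segment_bd M s} = Half ` {a \<in> X. x \<in> segment_bd M (Half a)}" by auto
  then show ?thesis by (simp add: mem_mod2_sum card_image inj_on_def)
qed

lemma mem_boundary_Dual_Half:
  "x \<in> mod2_sum (Dual_Half ` X) (segment_bd M)
    \<longleftrightarrow> odd (card {a \<in> X. x \<in> segment_bd M (Dual_Half a)})"
proof -
  have "{s \<in> Dual_Half ` X. x \<in> segment_bd M s}
      = Dual_Half ` {a \<in> X. x \<in> segment_bd M (Dual_Half a)}" by auto
  then show ?thesis by (simp add: mem_mod2_sum card_image inj_on_def)
qed

text \<open>
  Both halves of an edge, and both halves of its dual edge, end at their crossing point, so that no
  set of edges or of dual edges has a boundary there.
\<close>

lemma even_card_on_edge:
  assumes "A \<subseteq> inner_edges M H"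
  shows "even (card {a \<in> \<Union>A. e = edge_of M a})"
proof (cases "\<exists>a \<in> \<Union>A. e = edge_of M a")
  case True
  then obtain a where a: "a \<in> \<Union>A" "e = edge_of M a" by auto
  have A: "A \<subseteq> edges M" using assms inner_edges_subset by auto
  have "a \<in> arcs (skel M)" using a(1) Union_subset_inner_arcs[OF assms] inner_arcs_subset by auto
  moreover have "{b \<in> \<Union>A. e = edge_of M b} = {a, opp M a}"
    using a opp_mem_Union_edges[OF A] unfolding a(2) edge_of_eq_iff
    by (auto simp del: Union_iff)
  ultimately show ?thesis using arev_neq[of a] by simp
next
  case False
  then have "{a \<in> \<Union>A. e = edge_of M a} = {}" by auto
  then show ?thesis by (metis card.empty even_zero)
qed

lemma rel_cycle_in_cycles1:
  assumes "rel_cycle M H A"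
  shows "Half ` \<Union>A \<in> cycles1 (segment_bd M) (surface_segments M H) (bdry_points M H)"
proof -
  have A: "A \<subseteq> inner_edges M H" using assms by (simp add: rel_cycle_def)
  note inner = Union_subset_inner_arcs[OF A]
  have "x \<in> bdry_points M H" if x: "odd (card {a \<in> \<Union>A. x \<in> segment_bd M (Half a)})" for x
  proof (cases x)
    case (Vertex v)
    with x have odd: "odd (card {a \<in> \<Union>A. tail (skel M) a = v})" by (simp add: eq_commute)
    then have "{a \<in> \<Union>A. tail (skel M) a = v} \<noteq> {}" by (metis card.empty even_zero)
    then obtain a where "a \<in> inner_arcs M H" "tail (skel M) a = v" using inner by auto
    then have "v \<in> Defs.inner_verts M H" by (auto simp: Defs.inner_verts_def inner_arcs_def)
    then show ?thesis
      using assms odd Vertex by (auto simp: rel_cycle_def bdry_points_def)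
  next
    case (Crossing e)
    then show ?thesis using x even_card_on_edge[OF A, of e] by simp
  next
    case (Dual_Vertex f)
    then show ?thesis using x by simp
  qed
  moreover have "Half ` \<Union>A \<subseteq> surface_segments M H" using inner by (auto simp: surface_segments_def)
  ultimately show ?thesis by (auto simp: cycles1_def mem_boundary_Half)
qed

lemma polygon_in_cycles1:
  assumes "polygon M H P"
  shows "Dual_Half ` \<Union>P \<in> cycles1 (segment_bd M) (surface_segments M H) {}"
proof -
  have P: "P \<subseteq> inner_edges M H" using assms by (simp add: polygon_def)
  note inner = Union_subset_inner_arcs[OF P]
  have "even (card {a \<in> \<Union>P. x \<in> segment_bd M (Dual_Half a)})" for x
  proof (cases x)
    case (Dual_Vertex f)
    show ?thesis
    proof (cases "f \<in> inner_faces M H")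
      case True
      then show ?thesis using assms Dual_Vertex by (simp add: polygon_def eq_commute)
    next
      case False
      have "face_of M a \<in> inner_faces M H" if "a \<in> \<Union>P" for a
        using that inner face_in_inner_faces by blast
      with False have "{a \<in> \<Union>P. Dual_Vertex f \<in> segment_bd M (Dual_Half a)} = {}" by auto
      then show ?thesis unfolding Dual_Vertex by (metis card.empty even_zero)
    qed
  next
    case (Crossing e)
    then show ?thesis using even_card_on_edge[OF P, of e] by simp
  qed simp
  moreover have "Dual_Half ` \<Union>P \<subseteq> surface_segments M H"
    using inner by (auto simp: surface_segments_def inner_arcs_def)
  ultimately show ?thesis by (auto simp: cycles1_def mem_boundary_Dual_Half)
qed


lemma odd_edges_Cons: "odd_edges M (a # w) = sym_diff {edge_of M a} (odd_edges M w)"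
  by (auto simp: odd_edges_def)

lemma Union_sym_diff_edges:
  assumes "A \<subseteq> edges M" "B \<subseteq> edges M"
  shows "\<Union>(sym_diff A B) = sym_diff (\<Union>A) (\<Union>B)"
proof -
  have AB: "sym_diff A B \<subseteq> edges M" using assms by auto
  have "a \<in> \<Union>(sym_diff A B) \<longleftrightarrow> a \<in> sym_diff (\<Union>A) (\<Union>B)" for a
    using mem_Union_edges[OF AB, of a] mem_Union_edges[OF assms(1), of a]
      mem_Union_edges[OF assms(2), of a] by (simp only: Un_iff Diff_iff)
  then show ?thesis by blast
qed

lemma odd_card_Union_sym_diff:
  assumes A: "A \<subseteq> inner_edges M H" and B: "B \<subseteq> inner_edges M H"
  shows "odd (card {a \<in> \<Union>(sym_diff A B). Q a}) \<longleftrightarrow>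
    odd (card {a \<in> \<Union>A. Q a}) \<noteq> odd (card {a \<in> \<Union>B. Q a})"
proof -
  have "\<Union>(sym_diff A B) = sym_diff (\<Union>A) (\<Union>B)"
    using A B inner_edges_subset by (intro Union_sym_diff_edges) auto
  then have "{a \<in> \<Union>(sym_diff A B). Q a} = sym_diff {a \<in> \<Union>A. Q a} {a \<in> \<Union>B. Q a}" by auto
  moreover have "finite {a \<in> \<Union>A. Q a}" "finite {a \<in> \<Union>B. Q a}"
    by (rule finite_subset[OF _ finite_Union[OF A]], blast)
      (rule finite_subset[OF _ finite_Union[OF B]], blast)
  ultimately show ?thesis by (simp only: odd_card_sym_diff)
qed

text \<open>
  Every step of the walk changes the parity of the degree at both of its ends; the changes
  cancel at the intermediate vertices.
\<close>

lemma walk_endpoints: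
  assumes "set w \<subseteq> inner_arcs M H" "pre_digraph.cas (inner_graph M H) u w v"
  shows "odd_edges M w \<subseteq> inner_edges M H \<and>
    (odd (card {a \<in> \<Union>(odd_edges M w). tail (skel M) a = x}) \<longleftrightarrow> (x = u) \<noteq> (x = v))"
  using assms
proof (induction w arbitrary: u)
  case Nil
  then show ?case by (auto simp: odd_edges_def pre_digraph.cas.simps)
next
  case (Cons a w)
  let ?w = "odd_edges M w" and ?at = "\<lambda>X. {a \<in> X. tail (skel M) a = x}"
  have a: "a \<in> inner_arcs M H" "a \<in> arcs (skel M)"
    using Cons.prems inner_arcs_subset by auto
  have u: "tail (skel M) a = u" and "pre_digraph.cas (inner_graph M H) (head (skel M) a) w v"
    using Cons.prems by (simp_all add: pre_digraph.cas.simps inner_graph_def)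
  then have IH: "?w \<subseteq> inner_edges M H"
    "odd (card (?at (\<Union>?w))) \<longleftrightarrow> (x = head (skel M) a) \<noteq> (x = v)"
    using Cons by auto
  have e: "{edge_of M a} \<subseteq> inner_edges M H" using a by (auto simp: inner_edges_def)
  have "?at (edge_of M a) = {b. b = a \<and> x = u} \<union> {b. b = opp M a \<and> x = head (skel M) a}"
    using u a by (auto simp: edge_of_def)
  also have "odd (card \<dots>) \<longleftrightarrow> (x = u) \<noteq> (x = head (skel M) a)"
    using arev_neq[OF a(2)] by (cases "x = u"; cases "x = head (skel M) a") auto
  finally have at_e: "odd (card (?at (edge_of M a))) \<longleftrightarrow> (x = u) \<noteq> (x = head (skel M) a)" .
  have "odd (card (?at (\<Union>(odd_edges M (a # w))))) \<longleftrightarrow> (x = u) \<noteq> (x = v)"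
    unfolding odd_edges_Cons odd_card_Union_sym_diff[OF e IH(1)] using at_e IH(2) by auto
  then show ?case using e IH(1) by (auto simp: odd_edges_Cons)
qed

lemma rel_cycle_odd_edges:
  assumes "pre_digraph.awalk (inner_graph M H) u w v"
    and "u = v \<or> u \<in> bdry_verts M H \<and> v \<in> bdry_verts M H"
  shows "rel_cycle M H (odd_edges M w)"
proof -
  have "set w \<subseteq> inner_arcs M H" "pre_digraph.cas (inner_graph M H) u w v"
    using assms(1) by (simp_all add: pre_digraph.awalk_def inner_graph_def)
  note w = walk_endpoints[OF this]
  show ?thesis unfolding rel_cycle_def
  proof (intro conjI ballI)
    fix x assume "x \<in> Defs.inner_verts M H - bdry_verts M H"
    then have "\<not> ((x = u) \<noteq> (x = v))" using assms(2) by auto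
    then show "even (card {a \<in> \<Union>(odd_edges M w). tail (skel M) a = x})" using w[of x] by blast
  qed (use w in blast)
qed

lemma rel_cycle_sym_diff:
  assumes "rel_cycle M H A" "rel_cycle M H B"
  shows "rel_cycle M H (sym_diff A B)"
proof -
  have A: "A \<subseteq> inner_edges M H" and B: "B \<subseteq> inner_edges M H"
    using assms by (simp_all add: rel_cycle_def)
  have "even (card {a \<in> \<Union>(sym_diff A B). tail (skel M) a = v})"
    if "v \<in> Defs.inner_verts M H - bdry_verts M H" for v
    using odd_card_Union_sym_diff[OF A B, of "\<lambda>a. tail (skel M) a = v"] assms that
    unfolding rel_cycle_def by blast
  then show ?thesis using A B by (auto simp: rel_cycle_def)
qed

lemma rel_cycle_mod2_sum:
  assumes "finite I" "\<And>i. i \<in> I \<Longrightarrow> rel_cycle M H (A i)"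
  shows "rel_cycle M H (mod2_sum I A)"
  using assms
  by (induction I rule: finite_induct) (auto simp: mod2_sum_insert rel_cycle_sym_diff, simp add: rel_cycle_def)

lemma Half_Union_mod2_sum:
  assumes "finite I" "\<And>i. i \<in> I \<Longrightarrow> A i \<subseteq> edges M"
  shows "Half ` \<Union>(mod2_sum I A) = mod2_sum I (\<lambda>i. Half ` \<Union>(A i))"
  using assms
proof (induction I rule: finite_induct)
  case (insert i I)
  then have "mod2_sum I A \<subseteq> edges M" by (intro mod2_sum_subset) auto
  then have "\<Union>(sym_diff (A i) (mod2_sum I A)) = sym_diff (\<Union>(A i)) (\<Union>(mod2_sum I A))"
    using insert.prems by (intro Union_sym_diff_edges) auto
  moreover have "Half ` sym_diff X Y = sym_diff (Half ` X) (Half ` Y)" for X Y :: "'a set"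
    by auto
  ultimately show ?case unfolding mod2_sum_insert[OF insert.hyps(1,2)] using insert by simp
qed simp

lemma H1_rel_finprod:
  assumes "finite I" "\<And>i. i \<in> I \<Longrightarrow> rel_cycle M H (A i)"
  shows "finprod (H1_rel M H) (\<lambda>i. rel_class M H (A i)) I = rel_class M H (mod2_sum I A)"
proof -
  have "A i \<subseteq> edges M" if "i \<in> I" for i
    using assms(2)[OF that] inner_edges_subset by (auto simp: rel_cycle_def)
  then show ?thesis
    using relative.finprod_hclass(2)[OF assms(1), of "\<lambda>i. Half ` \<Union>(A i)"] assms rel_cycle_in_cycles1
    by (simp add: H1_rel_def rel_class_def Half_Union_mod2_sum)
qed

text \<open>
  The family chosen by \<open>defect\<close> is characterised by the class of its mod 2 union, while the basis
  property speaks of the product of the classes. Both describe the same family, which is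
  therefore unique.
\<close>

lemma defect_represents:
  assumes "path_basis M H \<gamma>s" "\<epsilon> \<in> carrier (H1_rel M H)"
  shows "rel_cycle M H (defect M H \<gamma>s \<epsilon>)" "rel_class M H (defect M H \<gamma>s \<epsilon>) = \<epsilon>"
proof -
  define sub where "sub = (\<lambda>I. mod2_sum I (\<lambda>i. odd_edges M (\<gamma>s ! i)))"
  have cycle: "rel_cycle M H (odd_edges M (\<gamma>s ! i))" if "i < length \<gamma>s" for i
    using assms(1) that rel_cycle_odd_edges unfolding path_basis_def by (metis nth_mem)
  have "finprod (H1_rel M H) (\<lambda>i. rel_class M H (odd_edges M (\<gamma>s ! i))) I = rel_class M H (sub I)"
    if "I \<subseteq> {..<length \<gamma>s}" for I
    unfolding sub_def using that finite_subset[OF that] cycle by (intro H1_rel_finprod) auto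
  then have "(I \<subseteq> {..<length \<gamma>s} \<and>
      finprod (H1_rel M H) (\<lambda>i. rel_class M H (odd_edges M (\<gamma>s ! i))) I = \<epsilon>) \<longleftrightarrow>
    (I \<subseteq> {..<length \<gamma>s} \<and> rel_class M H (sub I) = \<epsilon>)" for I by auto
  moreover have "\<exists>!I. I \<subseteq> {..<length \<gamma>s} \<and>
      finprod (H1_rel M H) (\<lambda>i. rel_class M H (odd_edges M (\<gamma>s ! i))) I = \<epsilon>"
    using assms by (simp add: path_basis_def)
  ultimately have "\<exists>!I. I \<subseteq> {..<length \<gamma>s} \<and> rel_class M H (sub I) = \<epsilon>" by simp
  note the_family = theI'[OF this]
  define I where "I = (THE I. I \<subseteq> {..<length \<gamma>s} \<and> rel_class M H (sub I) = \<epsilon>)"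
  have I: "I \<subseteq> {..<length \<gamma>s}" "rel_class M H (sub I) = \<epsilon>"
    using the_family by (simp_all add: I_def)
  have defect: "defect M H \<gamma>s \<epsilon> = sub I" by (simp add: defect_def I_def sub_def Let_def)
  show "rel_class M H (defect M H \<gamma>s \<epsilon>) = \<epsilon>" using I defect by simp
  show "rel_cycle M H (defect M H \<gamma>s \<epsilon>)"
    unfolding defect sub_def using I cycle finite_subset[OF I(1)]
    by (intro rel_cycle_mod2_sum) auto
qed


section \<open>The intersection form is well defined\<close>

text \<open>
  If the edges of \<open>A\<close> that belong to \<open>Q\<close> are those with exactly one of their two arcs in \<open>q\<close>, then summing
  over \<open>A\<close> the number of arcs in \<open>q\<close> counts, modulo 2, the edges of \<open>Q \<inter> A\<close>.
\<close>

lemma odd_card_Int: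
  assumes "Q \<subseteq> inner_edges M H" "A \<subseteq> inner_edges M H"
    and "\<And>a. a \<in> \<Union>A \<Longrightarrow> a \<in> \<Union>Q \<longleftrightarrow> (a \<in> q) \<noteq> (opp M a \<in> q)"
  shows "odd (card (Q \<inter> A)) \<longleftrightarrow> odd (card (\<Union>A \<inter> q))"
proof -
  have A: "A \<subseteq> edges M" and Q: "Q \<subseteq> edges M" using assms inner_edges_subset by auto
  have fin: "finite A" using assms finite_inner_edges by (auto intro: finite_subset)
  have e: "\<exists>a \<in> \<Union>A. e = edge_of M a \<and> a \<in> arcs (skel M)" if eA: "e \<in> A" for e
  proof -
    obtain a where a: "e = edge_of M a" "a \<in> arcs (skel M)" using eA A unfolding edges_def by blast
    then have "a \<in> \<Union>A" using eA by (auto simp: edge_of_def)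
    with a show ?thesis by blast
  qed
  have mem: "odd (card (e \<inter> q)) \<longleftrightarrow> e \<in> Q" if "e \<in> A" for e
    using e[OF that] assms(3) card_edge_Int mem_Union_edges[OF Q] by metis
  have "card (\<Union>A \<inter> q) = card (\<Union>e\<in>A. e \<inter> q)" by (rule arg_cong[of _ _ card]) auto
  also have "\<dots> = (\<Sum>e\<in>A. card (e \<inter> q))"
  proof (rule card_UN_disjoint[OF fin])
    show "\<forall>e\<in>A. finite (e \<inter> q)" using e by (auto simp: edge_of_def)
    show "\<forall>e\<in>A. \<forall>e'\<in>A. e \<noteq> e' \<longrightarrow> e \<inter> q \<inter> (e' \<inter> q) = {}"
    proof (intro ballI impI)
      fix e e' assume "e \<in> A" "e' \<in> A" "e \<noteq> e'"
      moreover have "e = edge_of M a" if "e \<in> A" "a \<in> e" for e a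
        using that A by (auto simp: edges_def edge_of_def)
      ultimately show "e \<inter> q \<inter> (e' \<inter> q) = {}" by blast
    qed
  qed
  finally have "odd (card (\<Union>A \<inter> q)) \<longleftrightarrow> odd (card {e \<in> A. odd (card (e \<inter> q))})"
    using even_sum_iff[OF fin, of "\<lambda>e. card (e \<inter> q)"] by simp
  also have "{e \<in> A. odd (card (e \<inter> q))} = Q \<inter> A" using mem by auto
  finally show ?thesis by simp
qed

text \<open>
  Here \<open>q\<close> is the set of corners bounded by the difference. No half of an edge occurs in this
  difference, so \<open>q\<close> does not change from one corner around a vertex to the next. It is thus
  given by a set of vertices, and \<open>a \<in> q\<close> says that the tail of \<open>a\<close> is in that set.
\<close>

lemma dual_boundary_is_cut:
  assumes P: "P \<subseteq> edges M" "P' \<subseteq> edges M" and eq: "dual_class M H P = dual_class M H P'"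
  obtains q where "q \<subseteq> surface_quads M H" "\<And>a. a \<in> q \<longleftrightarrow> rot M a \<in> q"
    "\<And>a. a \<in> \<Union>(sym_diff P P') \<longleftrightarrow> (a \<in> q) \<noteq> (opp M a \<in> q)"
proof -
  obtain q b where q: "q \<subseteq> surface_quads M H" "b \<subseteq> {}"
    "sym_diff (Dual_Half ` \<Union>P) (Dual_Half ` \<Union>P') = sym_diff (mod2_sum q (quad_bd M)) b"
    using eq unfolding dual_class_def by (rule hclass_eqD)
  have "sym_diff (Dual_Half ` \<Union>P) (Dual_Half ` \<Union>P') = Dual_Half ` \<Union>(sym_diff P P')"
    unfolding Union_sym_diff_edges[OF P] by blast
  with q have bd: "mod2_sum q (quad_bd M) = Dual_Half ` \<Union>(sym_diff P P')" by simp
  have fin: "finite q" using q(1) finite_surface_quads by (rule finite_subset)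
  have rot: "a \<in> q \<longleftrightarrow> rot M a \<in> q" for a
    using Half_rot_in_boundary[OF fin, of a] unfolding bd by blast
  have "a \<in> \<Union>(sym_diff P P') \<longleftrightarrow> (a \<in> q) \<noteq> (opp M a \<in> q)" for a
  proof -
    obtain c where c: "a = rot M c" using permutes_surj[OF rot_permutes] by blast
    have "a \<in> \<Union>(sym_diff P P') \<longleftrightarrow> Dual_Half a \<in> Dual_Half ` \<Union>(sym_diff P P')" by blast
    also have "\<dots> \<longleftrightarrow> (a \<in> q) \<noteq> (opp M a \<in> q)"
      using Dual_Half_rot_in_boundary[OF fin, of c] rot[of c] unfolding bd c by simp
    finally show ?thesis .
  qed
  with q(1) rot show thesis by (rule that)
qed

text \<open>
  Dually, the set of corners is now given by a set of faces, and \<open>a \<in> r\<close> says that the face to the left of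
  \<open>a\<close> belongs to it. The corner named \<open>opp a\<close> is the one in this face, whence the use of \<open>opp\<close> below. The
  equivalence is restricted to inner arcs because the coefficients at boundary segments are arbitrary.
\<close>

lemma rel_boundary_is_cut:
  assumes A: "A \<subseteq> edges M" "A' \<subseteq> edges M" and eq: "rel_class M H A = rel_class M H A'"
  obtains r where "\<And>a. a \<in> r \<Longrightarrow> face_of M a \<notin> H" "\<And>a. a \<in> r \<longleftrightarrow> rot M (opp M a) \<in> r"
    "\<And>a. a \<in> inner_arcs M H \<Longrightarrow> a \<in> \<Union>(sym_diff A A') \<longleftrightarrow> (a \<in> r) \<noteq> (opp M a \<in> r)"
proof -
  obtain q b where q: "q \<subseteq> surface_quads M H" "b \<subseteq> bdry_segments M H"
    "sym_diff (Half ` \<Union>A) (Half ` \<Union>A') = sym_diff (mod2_sum q (quad_bd M)) b"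
    using eq unfolding rel_class_def by (rule hclass_eqD)
  have "sym_diff (Half ` \<Union>A) (Half ` \<Union>A') = Half ` \<Union>(sym_diff A A')"
    unfolding Union_sym_diff_edges[OF A] by blast
  with q(3) have "Half ` \<Union>(sym_diff A A') = sym_diff (mod2_sum q (quad_bd M)) b" by simp
  then have bd: "s \<in> mod2_sum q (quad_bd M) \<longleftrightarrow> s \<in> Half ` \<Union>(sym_diff A A')" if "s \<notin> b" for s
    using that by (simp only: Un_iff Diff_iff) simp
  have b: "Dual_Half a \<notin> b" for a using q(2) by (auto simp: bdry_segments_def)
  have fin: "finite q" using q(1) finite_surface_quads by (rule finite_subset)
  have rot: "a \<in> q \<longleftrightarrow> opp M (rot M a) \<in> q" for a
    using Dual_Half_rot_in_boundary[OF fin, of a] bd[OF b, of "rot M a"] by blast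
  \<comment> \<open>The corner named \<open>opp a\<close> lies in the face to the left of \<open>a\<close>.\<close>
  define r where "r = {a. opp M a \<in> q}"
  have "a \<in> \<Union>(sym_diff A A') \<longleftrightarrow> (a \<in> r) \<noteq> (opp M a \<in> r)" if a: "a \<in> inner_arcs M H" for a
  proof -
    obtain c where c: "a = rot M c" using permutes_surj[OF rot_permutes] by blast
    have "Half a \<notin> b" using a q(2) by (auto simp: bdry_segments_def bdry_arcs_def inner_arcs_def)
    have "a \<in> \<Union>(sym_diff A A') \<longleftrightarrow> Half a \<in> Half ` \<Union>(sym_diff A A')" by blast
    also have "\<dots> \<longleftrightarrow> (a \<in> r) \<noteq> (opp M a \<in> r)"
      using Half_rot_in_boundary[OF fin, of c] rot[of c] bd[OF \<open>Half a \<notin> b\<close>]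
      unfolding c r_def by auto
    finally show ?thesis .
  qed
  moreover have "face_of M a \<notin> H" if "a \<in> r" for a
    using that q(1) by (auto simp: r_def surface_quads_def)
  moreover have "a \<in> r \<longleftrightarrow> rot M (opp M a) \<in> r" for a
    using rot[of "opp M a"] by (simp add: r_def)
  ultimately show thesis using that by blast
qed

lemma odd_card_sym_diff_Int:
  assumes "finite P" "finite P'" "even (card (sym_diff P P' \<inter> A))"
  shows "odd (card (P \<inter> A)) \<longleftrightarrow> odd (card (P' \<inter> A))"
proof -
  have "sym_diff P P' \<inter> A = sym_diff (P \<inter> A) (P' \<inter> A)" by auto
  then show ?thesis using odd_card_sym_diff[of "P \<inter> A" "P' \<inter> A"] assms by auto
qed

text \<open>
  The arcs of \<open>A\<close> in \<open>q\<close> are counted vertex by vertex: they are all the arcs of \<open>A\<close> out of vertices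
  whose faces all belong to the surface, and at such vertices \<open>A\<close> has even degree.
\<close>

lemma intersection_dual_class_cong:
  assumes P: "polygon M H P" "polygon M H P'" "dual_class M H P = dual_class M H P'"
    and A: "rel_cycle M H A"
  shows "odd (card (P \<inter> A)) \<longleftrightarrow> odd (card (P' \<inter> A))"
proof (rule odd_card_sym_diff_Int)
  have PE: "P \<subseteq> inner_edges M H" "P' \<subseteq> inner_edges M H" "A \<subseteq> inner_edges M H"
    using P A by (simp_all add: polygon_def rel_cycle_def)
  show "finite P" "finite P'" using PE finite_inner_edges by (auto intro: finite_subset)
  have "P \<subseteq> edges M" "P' \<subseteq> edges M" using PE inner_edges_subset by auto
  then obtain q where q: "q \<subseteq> surface_quads M H" "\<And>a. a \<in> q \<longleftrightarrow> rot M a \<in> q"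
    and cut: "\<And>a. a \<in> \<Union>(sym_diff P P') \<longleftrightarrow> (a \<in> q) \<noteq> (opp M a \<in> q)"
    using P(3) by (rule dual_boundary_is_cut) blast
  have arcs: "\<Union>A \<subseteq> inner_arcs M H" using PE(3) by (rule Union_subset_inner_arcs)
  have "even (card (\<Union>A \<inter> q))"
  proof (rule even_card_fibres[where f = "tail (skel M)"])
    show "finite (\<Union>A \<inter> q)" using finite_Union[OF PE(3)] by simp
    fix v assume "v \<in> tail (skel M) ` (\<Union>A \<inter> q)"
    then obtain a where a: "a \<in> \<Union>A" "a \<in> q" "a \<in> arcs (skel M)" "tail (skel M) a = v"
      using arcs inner_arcs_subset by blast
    have full: "b \<in> q" if "b \<in> arcs (skel M)" "tail (skel M) b = v" for b
      using full_at_vertex[of a b q] that a q(2) by simp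
    have "face_of M b \<notin> H" if b: "b \<in> out_arcs (skel M) v" for b
    proof -
      obtain c where c: "b = rot M c" using permutes_surj[OF rot_permutes] by blast
      moreover have "c \<in> arcs (skel M)" using b c by simp
      ultimately have "c \<in> q" using full[of c] b by simp
      then show ?thesis using q(1) c by (auto simp: surface_quads_def)
    qed
    moreover have "v \<in> verts (skel M)" "a \<in> out_arcs (skel M) v" using a by auto
    ultimately have "v \<in> Defs.inner_verts M H - bdry_verts M H"
      unfolding Defs.inner_verts_def bdry_verts_def by blast
    moreover have "{a \<in> \<Union>A \<inter> q. tail (skel M) a = v} = {a \<in> \<Union>A. tail (skel M) a = v}"
      using full arcs inner_arcs_subset by blast
    ultimately show "even (card {a \<in> \<Union>A \<inter> q. tail (skel M) a = v})"
      using A by (simp add: rel_cycle_def)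
  qed
  then show "even (card (sym_diff P P' \<inter> A))"
    using odd_card_Int[of "sym_diff P P'" A q] cut PE by blast
qed

text \<open>
  The arcs of \<open>P\<close> in \<open>r\<close> are counted face by face, each of these faces belonging to the surface.
\<close>

lemma intersection_rel_class_cong:
  assumes A: "rel_cycle M H A" "rel_cycle M H A'" "rel_class M H A = rel_class M H A'"
    and P: "polygon M H P"
  shows "odd (card (P \<inter> A)) \<longleftrightarrow> odd (card (P \<inter> A'))"
proof -
  have AE: "A \<subseteq> inner_edges M H" "A' \<subseteq> inner_edges M H" "P \<subseteq> inner_edges M H"
    using P A by (simp_all add: polygon_def rel_cycle_def)
  have fin: "finite A" "finite A'" using AE finite_inner_edges by (auto intro: finite_subset)
  have "A \<subseteq> edges M" "A' \<subseteq> edges M" using AE inner_edges_subset by auto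
  then obtain r where r: "\<And>a. a \<in> r \<Longrightarrow> face_of M a \<notin> H" "\<And>a. a \<in> r \<longleftrightarrow> rot M (opp M a) \<in> r"
    and cut: "\<And>a. a \<in> inner_arcs M H \<Longrightarrow> a \<in> \<Union>(sym_diff A A') \<longleftrightarrow> (a \<in> r) \<noteq> (opp M a \<in> r)"
    using A(3) by (rule rel_boundary_is_cut) blast
  have arcs: "\<Union>P \<subseteq> inner_arcs M H" using AE(3) by (rule Union_subset_inner_arcs)
  have "even (card (\<Union>P \<inter> r))"
  proof (rule even_card_fibres[where f = "face_of M"])
    show "finite (\<Union>P \<inter> r)" using finite_Union[OF AE(3)] by simp
    fix f assume "f \<in> face_of M ` (\<Union>P \<inter> r)"
    then obtain a where a: "a \<in> \<Union>P" "a \<in> r" "face_of M a = f" by blast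
    have "b \<in> r" if "face_of M b = f" for b
      using full_on_face[of b a r] that a r(2) by simp
    then have "{a \<in> \<Union>P \<inter> r. face_of M a = f} = {a \<in> \<Union>P. face_of M a = f}" by blast
    moreover have "f \<in> inner_faces M H" using a arcs face_in_inner_faces by blast
    ultimately show "even (card {a \<in> \<Union>P \<inter> r. face_of M a = f})"
      using P by (simp add: polygon_def)
  qed
  moreover have "sym_diff A A' \<subseteq> inner_edges M H" using AE by blast
  ultimately have "even (card (sym_diff A A' \<inter> P))"
    using odd_card_Int[of "sym_diff A A'" P r] cut arcs AE(3) by blast
  then show ?thesis unfolding Int_commute[of P] by (rule odd_card_sym_diff_Int[OF fin])
qed

lemma intersection_form_eq:
  assumes P: "polygon M H P" and A: "rel_cycle M H A"
  shows "intersection_form M H (dual_class M H P) (rel_class M H A) = card (P \<inter> A) mod 2"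
  unfolding intersection_form_def
proof (rule the_equality)
  show "\<forall>P' A'. polygon M H P' \<and> dual_class M H P' = dual_class M H P \<and> rel_cycle M H A' \<and>
    rel_class M H A' = rel_class M H A \<longrightarrow> card (P \<inter> A) mod 2 = card (P' \<inter> A') mod 2"
  proof (intro allI impI, elim conjE)
    fix P' A'
    assume *: "polygon M H P'" "dual_class M H P' = dual_class M H P" "rel_cycle M H A'"
      "rel_class M H A' = rel_class M H A"
    have "odd (card (P \<inter> A)) \<longleftrightarrow> odd (card (P' \<inter> A))"
      using intersection_dual_class_cong[OF P *(1) *(2)[symmetric] A] .
    also have "\<dots> \<longleftrightarrow> odd (card (P' \<inter> A'))"
      using intersection_rel_class_cong[OF A *(3) *(4)[symmetric] *(1)] .
    finally show "card (P \<inter> A) mod 2 = card (P' \<inter> A') mod 2" by (metis odd_iff_mod_2_eq_one even_iff_mod_2_eq_zero)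
  qed
qed (use P A in blast)


section \<open>The high-temperature expansion\<close>

lemma exp_spin:
  fixes J s :: real
  assumes "s = 1 \<or> s = -1"
  shows "exp (J * s) = cosh J * (s * tanh J + 1)"
proof -
  have "cosh J * tanh J = sinh J" by (simp add: tanh_def)
  then have "cosh J * (s * tanh J + 1) = cosh J + s * sinh J" by (simp add: algebra_simps)
  also have "\<dots> = exp (J * s)" using assms by (auto simp: cosh_def sinh_def field_simps)
  finally show ?thesis ..
qed

lemma finite_inner_faces: "finite (inner_faces M H)"
  by (simp add: inner_faces_def faces_def finite_arcs)

text \<open>
  The monomial is a product over the faces of powers of single spins; summing over a spin gives 2 for
  an even exponent and 0 for an odd one.
\<close>

lemma sum_spins_monomial:
  assumes P: "P \<subseteq> inner_edges M H"
  shows "(\<Sum>\<sigma>\<in>spins M H. \<Prod>e\<in>P. \<Prod>a\<in>e. \<sigma> (face_of M a)) =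
    (if polygon M H P then 2 ^ card (inner_faces M H) else 0)"
proof -
  let ?n = "\<lambda>f. card {a \<in> \<Union>P. face_of M a = f}"
  have "(\<Prod>e\<in>P. \<Prod>a\<in>e. \<sigma> (face_of M a)) = (\<Prod>f\<in>inner_faces M H. \<sigma> f ^ ?n f)"
    for \<sigma> :: "'a set \<Rightarrow> real"
  proof -
    have "e \<inter> e' = {}" if "e \<in> P" "e' \<in> P" "e \<noteq> e'" for e e'
    proof -
      have "e = edge_of M a" if "e \<in> P" "a \<in> e" for e a
        using that P inner_edges_subset by (fastforce simp: edges_def edge_of_def)
      then show ?thesis using that by blast
    qed
    moreover have "finite e" if "e \<in> P" for e
      using that finite_Union[OF P] by (meson Sup_upper finite_subset)
    ultimately have "(\<Prod>e\<in>P. \<Prod>a\<in>e. \<sigma> (face_of M a)) = (\<Prod>a\<in>\<Union>P. \<sigma> (face_of M a))"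
      by (subst prod.Union_disjoint) auto
    also have "\<dots> = (\<Prod>f\<in>inner_faces M H. \<Prod>a\<in>{a \<in> \<Union>P. face_of M a = f}. \<sigma> (face_of M a))"
      using finite_Union[OF P] finite_inner_faces Union_subset_inner_arcs[OF P] face_in_inner_faces
      by (intro prod.group[symmetric]) auto
    also have "\<dots> = (\<Prod>f\<in>inner_faces M H. \<sigma> f ^ ?n f)"
      by (intro prod.cong refl) simp
    finally show ?thesis .
  qed
  then have "(\<Sum>\<sigma>\<in>spins M H. \<Prod>e\<in>P. \<Prod>a\<in>e. \<sigma> (face_of M a)) =
      (\<Prod>f\<in>inner_faces M H. \<Sum>s\<in>{-1, 1::real}. s ^ ?n f)"
    unfolding spins_def by (subst prod_sum_PiE[OF finite_inner_faces]) simp_all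
  also have "\<dots> = (\<Prod>f\<in>inner_faces M H. if even (?n f) then 2 else 0)"
    by (intro prod.cong refl) simp
  also have "\<dots> = (if polygon M H P then 2 ^ card (inner_faces M H) else 0)"
    using P finite_inner_faces by (auto simp: polygon_def prod_zero_iff)
  finally show ?thesis .
qed

text \<open>
  The set \<open>P\<close> collects the edges at which the second summand of \<open>cosh J * (1 + s * tanh J)\<close> is chosen.
\<close>

lemma Z_Ising_polygons:
  "Z_Ising M H J D = 2 ^ card (inner_faces M H) * (\<Prod>e\<in>inner_edges M H. cosh (J e)) *
    (\<Sum>P | polygon M H P. (-1) ^ card (P \<inter> D) * (\<Prod>e\<in>P. tanh (J e)))"
proof -
  let ?E = "inner_edges M H" and ?s = "\<lambda>\<sigma> e. \<Prod>a\<in>e. \<sigma> (face_of M a) :: real"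
  let ?d = "\<lambda>e. if e \<in> D then -1 else 1 :: real"
  have sign: "(\<Prod>e\<in>P. ?d e) = (-1) ^ card (P \<inter> D)" if "P \<subseteq> ?E" for P
    using that finite_inner_edges by (subst prod.If_cases) (auto intro: finite_subset)
  have weight: "exp (\<Sum>e\<in>?E. ?d e * J e * ?s \<sigma> e) = (\<Prod>e\<in>?E. cosh (J e)) *
      (\<Sum>P\<in>Pow ?E. (-1) ^ card (P \<inter> D) * (\<Prod>e\<in>P. tanh (J e)) * (\<Prod>e\<in>P. ?s \<sigma> e))"
    if \<sigma>: "\<sigma> \<in> spins M H" for \<sigma>
  proof -
    have unit: "?s \<sigma> e \<in> {1, -1}" if "e \<in> ?E" for e
    proof -
      have "\<sigma> (face_of M a) \<in> {1, -1}" if "a \<in> inner_arcs M H" for a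
        using \<sigma> face_in_inner_faces[OF that] by (auto simp: spins_def)
      moreover have "e \<subseteq> inner_arcs M H" using that Union_inner_edges by blast
      ultimately have "\<forall>a\<in>e. \<sigma> (face_of M a) \<in> {1, -1}" by blast
      then show ?thesis by (induction e rule: infinite_finite_induct) auto
    qed
    have "exp (\<Sum>e\<in>?E. ?d e * J e * ?s \<sigma> e) = (\<Prod>e\<in>?E. exp (J e * (?d e * ?s \<sigma> e)))"
      by (simp add: exp_sum finite_inner_edges mult_ac)
    also have "\<dots> = (\<Prod>e\<in>?E. cosh (J e) * (?d e * ?s \<sigma> e * tanh (J e) + 1))"
      using unit by (intro prod.cong refl exp_spin) fastforce
    also have "\<dots> = (\<Prod>e\<in>?E. cosh (J e)) * (\<Sum>P\<in>Pow ?E. \<Prod>e\<in>P. ?d e * ?s \<sigma> e * tanh (J e))"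
      by (simp add: prod.distrib prod_add finite_inner_edges)
    also have "(\<Sum>P\<in>Pow ?E. \<Prod>e\<in>P. ?d e * ?s \<sigma> e * tanh (J e)) =
        (\<Sum>P\<in>Pow ?E. (-1) ^ card (P \<inter> D) * (\<Prod>e\<in>P. tanh (J e)) * (\<Prod>e\<in>P. ?s \<sigma> e))"
      by (intro sum.cong refl) (simp only: prod.distrib sign[OF PowD] mult_ac)
    finally show ?thesis .
  qed
  have "Z_Ising M H J D = (\<Sum>\<sigma>\<in>spins M H. (\<Prod>e\<in>?E. cosh (J e)) *
      (\<Sum>P\<in>Pow ?E. (-1) ^ card (P \<inter> D) * (\<Prod>e\<in>P. tanh (J e)) * (\<Prod>e\<in>P. ?s \<sigma> e)))"
    unfolding Z_Ising_def by (intro sum.cong refl weight)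
  also have "\<dots> = (\<Prod>e\<in>?E. cosh (J e)) * (\<Sum>P\<in>Pow ?E.
      (-1) ^ card (P \<inter> D) * (\<Prod>e\<in>P. tanh (J e)) * (\<Sum>\<sigma>\<in>spins M H. \<Prod>e\<in>P. ?s \<sigma> e))"
    by (simp only: sum_distrib_left sum.swap[of _ _ "spins M H"])
  also have "(\<Sum>P\<in>Pow ?E.
      (-1) ^ card (P \<inter> D) * (\<Prod>e\<in>P. tanh (J e)) * (\<Sum>\<sigma>\<in>spins M H. \<Prod>e\<in>P. ?s \<sigma> e)) =
    (\<Sum>P | polygon M H P.
      (-1) ^ card (P \<inter> D) * (\<Prod>e\<in>P. tanh (J e)) * 2 ^ card (inner_faces M H))"
    using finite_inner_edges
    by (intro sum.mono_neutral_cong_right) (auto simp: sum_spins_monomial polygon_def)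
  finally show ?thesis by (simp add: sum_distrib_left mult_ac)
qed

lemma finite_carrier_H1: "finite (carrier (H1 M H))"
proof -
  have "cycles1 (segment_bd M) (surface_segments M H) {} \<subseteq> Pow (surface_segments M H)"
    by (auto simp: cycles1_def)
  then show ?thesis
    using finite_surface_segments by (auto simp: H1_def carrier_homology1 intro: finite_subset)
qed

lemma dual_class_in_H1:
  assumes "polygon M H P"
  shows "dual_class M H P \<in> carrier (H1 M H)"
  using polygon_in_cycles1[OF assms] by (simp add: H1_def carrier_homology1 dual_class_def)

text \<open>
  If no polygon configuration has class \<open>\<tau>\<close>, the defining condition of the intersection form at \<open>\<tau>\<close>
  is vacuous and determines no value; the inner sum is then empty, so this is harmless.
\<close>

lemma high_temperature_expansion:
  assumes D: "rel_cycle M H D" "rel_class M H D = \<epsilon>"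
  shows "Z_Ising M H J D = 2 ^ card (inner_faces M H) * (\<Prod>e\<in>inner_edges M H. cosh (J e)) *
    (\<Sum>\<tau>\<in>carrier (H1 M H). (-1) ^ intersection_form M H \<tau> \<epsilon> *
       (\<Sum>P\<in>polygons M H \<tau>. \<Prod>e\<in>P. tanh (J e)))"
proof -
  have "finite {P. polygon M H P}"
    using finite_inner_edges by (auto simp: polygon_def intro!: finite_subset[of _ "Pow (inner_edges M H)"])
  then have "(\<Sum>P | polygon M H P. (-1) ^ card (P \<inter> D) * (\<Prod>e\<in>P. tanh (J e))) =
      (\<Sum>\<tau>\<in>carrier (H1 M H). \<Sum>P | P \<in> Collect (polygon M H) \<and> dual_class M H P = \<tau>.
        (-1) ^ card (P \<inter> D) * (\<Prod>e\<in>P. tanh (J e)))"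
    using finite_carrier_H1 dual_class_in_H1 by (intro sum.group[symmetric]) auto
  also have "\<dots> = (\<Sum>\<tau>\<in>carrier (H1 M H). (-1) ^ intersection_form M H \<tau> \<epsilon> *
      (\<Sum>P\<in>polygons M H \<tau>. \<Prod>e\<in>P. tanh (J e)))"
  proof (intro sum.cong refl, unfold sum_distrib_left, rule sum.cong)
    fix \<tau> P assume "P \<in> polygons M H \<tau>"
    then have "intersection_form M H \<tau> \<epsilon> = card (P \<inter> D) mod 2"
      using intersection_form_eq D by (auto simp: polygons_def)
    then show "(-1) ^ card (P \<inter> D) * (\<Prod>e\<in>P. tanh (J e)) =
        (-1) ^ intersection_form M H \<tau> \<epsilon> * (\<Prod>e\<in>P. tanh (J e))"
      by (simp add: minus_one_power_iff)
  qed (simp add: polygons_def)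
  finally show ?thesis by (simp add: Z_Ising_polygons)
qed

end

theorem proposition7:
  fixes M :: "('v, 'a) cmap" and g p :: nat and B :: "nat \<Rightarrow> 'a set set" and H :: "'a set set"
    and J :: "'a set \<Rightarrow> real" and \<gamma>s :: "'a list list" and \<epsilon> :: "'a segment set set"
  assumes "embedded_graph M g"
    and "\<And>i. i < p \<Longrightarrow> disc M (B i)"
    and "\<And>i j. i < p \<Longrightarrow> j < p \<Longrightarrow> i \<noteq> j \<Longrightarrow> region_verts M (B i) \<inter> region_verts M (B j) = {}"
    and "H = (\<Union>i<p. B i)"
    and "\<And>e. e \<in> edges M \<Longrightarrow> J e > 0"
    and "path_basis M H \<gamma>s"
    and "\<epsilon> \<in> carrier (H1_rel M H)"
  shows "Z_Ising M H J (defect M H \<gamma>s \<epsilon>) =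
    2 ^ card (inner_faces M H) * (\<Prod>e \<in> inner_edges M H. cosh (J e)) *
    (\<Sum>\<tau> \<in> carrier (H1 M H). (-1) ^ intersection_form M H \<tau> \<epsilon> *
       (\<Sum>P \<in> polygons M H \<tau>. \<Prod>e \<in> P. tanh (J e)))"
proof -
  interpret fin_digraph "skel M" using assms(1) by (simp add: embedded_graph_def)
  interpret bidirected_digraph "skel M" "opp M" using assms(1) by (simp add: embedded_graph_def)
  interpret rotation_system M H
    by unfold_locales (use assms(1) in \<open>simp_all add: embedded_graph_def\<close>)
  show ?thesis by (intro high_temperature_expansion defect_represents assms(6,7))
qed

end
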